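(* Let $\gamma>0$ and let $F=(F_1,\dots,F_n):[B(\mathcal H)^n]_\gamma\to[B(\mathcal H)^n]_\gamma$ be a free holomorphic function such that $F(0)=0$ and $F'(0)=I_n$. Then $F(X_1,\dots,X_n)=(X_1,\dots,X_n)$ for all $(X_1,\dots,X_n)\in[B(\mathcal H)^n]_\gamma$. *)

theory Defs
  imports "HOL-Analysis.Analysis"
begin

text \<open>A complex Hilbert space is modelled as a real Hilbert space (real inner product,
complete) together with a complex structure jmul (multiplication by the imaginary unit),
which is real-linear, squares to minus the identity and is orthogonal.  The complex inner
product is then  cinner x y = inner x y + i * inner x (jmul y)  and its real part is the
real inner product; in particular the norm is the Hilbert space norm.\<close>

class complex_hilbert = real_inner + complete_space +
  fixes jmul :: "'a \<Rightarrow> 'a"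
  assumes jmul_add: "jmul (x + y) = jmul x + jmul y"
    and jmul_scaleR: "jmul (r *\<^sub>R x) = r *\<^sub>R jmul x"
    and jmul_jmul: "jmul (jmul x) = - x"
    and jmul_inner: "inner (jmul x) (jmul y) = inner x y"

definition scaleC :: "complex \<Rightarrow> 'a::complex_hilbert \<Rightarrow> 'a" where
  "scaleC c x = Re c *\<^sub>R x + Im c *\<^sub>R jmul x"

definition is_bop :: "('a::complex_hilbert \<Rightarrow> 'a) \<Rightarrow> bool" where
  "is_bop T \<longleftrightarrow> bounded_linear T \<and> (\<forall>x. T (jmul x) = jmul (T x))"

text \<open>The open noncommutative ball [B(H)^n]_gamma:
  tuples (X_0,...,X_{n-1}) of bounded operators with
  norm(X_0 X_0^* + ... + X_{n-1} X_{n-1}^*)^(1/2) < gamma.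
  (The Hilbert space adjoint of a complex-linear bounded operator coincides with its
  adjoint w.r.t. the real part of the inner product, which is adjoint below.)\<close>
definition nc_ball :: "nat \<Rightarrow> real \<Rightarrow> (nat \<Rightarrow> ('a::complex_hilbert \<Rightarrow> 'a)) set" where
  "nc_ball n \<gamma> = {X. (\<forall>i<n. is_bop (X i)) \<and>
      sqrt (onorm (\<lambda>h. \<Sum>i<n. X i (adjoint (X i) h))) < \<gamma>}"

definition words :: "nat \<Rightarrow> nat \<Rightarrow> nat list set" where
  "words n k = {\<alpha>. length \<alpha> = k \<and> set \<alpha> \<subseteq> {..<n}}"

definition word_op :: "(nat \<Rightarrow> ('a \<Rightarrow> 'a)) \<Rightarrow> nat list \<Rightarrow> ('a \<Rightarrow> 'a)" where
  "word_op X \<alpha> = foldr (\<lambda>i T. X i \<circ> T) \<alpha> id"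

definition hom_part :: "nat \<Rightarrow> (nat list \<Rightarrow> complex) \<Rightarrow> nat \<Rightarrow> (nat \<Rightarrow> ('a::complex_hilbert \<Rightarrow> 'a))
    \<Rightarrow> ('a \<Rightarrow> 'a)" where
  "hom_part n a k X = (\<lambda>h. \<Sum>\<alpha>\<in>words n k. scaleC (a \<alpha>) (word_op X \<alpha> h))"

definition fh_eval :: "nat \<Rightarrow> (nat list \<Rightarrow> complex) \<Rightarrow> (nat \<Rightarrow> ('a::complex_hilbert \<Rightarrow> 'a))
    \<Rightarrow> ('a \<Rightarrow> 'a)" where
  "fh_eval n a X = (\<lambda>h. \<Sum>k. hom_part n a k X h)"

text \<open>A free holomorphic function on [B(H)^n]_gamma (Popescu): a formal power series
  sum_alpha a_alpha Z_alpha in n noncommuting indeterminates whose radius of convergence R,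
  given by 1/R = limsup_k (sum_{|alpha|=k} |a_alpha|^2)^(1/(2k)), satisfies R >= gamma.\<close>
definition free_holomorphic :: "nat \<Rightarrow> real \<Rightarrow> (nat list \<Rightarrow> complex) \<Rightarrow> bool" where
  "free_holomorphic n \<gamma> a \<longleftrightarrow>
     limsup (\<lambda>k. ereal ((\<Sum>\<alpha>\<in>words n k. (cmod (a \<alpha>))\<^sup>2) powr (1 / (2 * real k))))
       \<le> ereal (1 / \<gamma>)"

text \<open>F'(0) for F = (F_1,...,F_n), F_i with coefficients a i: the n x n matrix
  [(\<partial>F_i/\<partial>Z_j)(0)], whose (i,j) entry is the coefficient of Z_j in F_i.\<close>
definition free_deriv0 :: "(nat \<Rightarrow> nat list \<Rightarrow> complex) \<Rightarrow> nat \<Rightarrow> nat \<Rightarrow> complex" where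
  "free_deriv0 a i j = a i [j]"

end

theory Submission
  imports Defs
begin

text \<open>Membership in the noncommutative ball is a bound on the row operator \<open>(h\<^sub>i) \<mapsto> \<Sum> X\<^sub>i h\<^sub>i\<close>,
  a norm condition that is convex and invariant under rotations \<open>X \<mapsto> e\<^sup>i\<^sup>\<theta> X\<close>.  Averaging
  \<open>e\<^sup>-\<^sup>i\<^sup>\<theta> F(e\<^sup>i\<^sup>\<theta> X)\<close> against the probability kernel \<open>1 + cos ((m - 1) \<theta>)\<close> therefore shows that
  the polynomial map \<open>G(X) = X + P\<^sub>m(X) / 2\<close>, where \<open>P\<^sub>m\<close> is the \<open>m\<close>-homogeneous part of \<open>F\<close>
  and \<open>m \<ge> 2\<close>, maps the closed ball to itself.  Cartan's iteration is then purely polynomial: the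
  \<open>m\<close>-homogeneous part of the \<open>N\<close>-th iterate of \<open>G\<close> is \<open>N P\<^sub>m / 2\<close>, and it is bounded
  independently of \<open>N\<close> by the Cauchy estimate, so \<open>P\<^sub>m = 0\<close>.\<close>

instance complex_hilbert \<subseteq> banach ..

section \<open>Complex scalar multiplication and bounded complex-linear operators\<close>

lemma scaleC_add_right: "scaleC c (x + y) = scaleC c x + scaleC c y"
  by (simp add: scaleC_def jmul_add algebra_simps)

lemma scaleC_add_left: "scaleC (c + d) x = scaleC c x + scaleC d x"
  by (simp add: scaleC_def algebra_simps)

lemma jmul_zero [simp]: "jmul (0::'a::complex_hilbert) = 0"
  using jmul_scaleR[of 0 "0::'a"] by simp

lemma scaleC_zero [simp]: "scaleC 0 x = 0" "scaleC c 0 = 0"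
  by (simp_all add: scaleC_def)

lemma scaleC_one [simp]: "scaleC 1 x = x"
  by (simp add: scaleC_def)

lemma scaleC_of_real: "scaleC (of_real r) x = r *\<^sub>R x"
  by (simp add: scaleC_def)

lemma scaleC_scaleC: "scaleC c (scaleC d x) = scaleC (c * d) x"
  by (simp add: scaleC_def jmul_add jmul_scaleR jmul_jmul algebra_simps)

lemma scaleC_sum_right: "scaleC c (\<Sum>i\<in>A. f i) = (\<Sum>i\<in>A. scaleC c (f i))"
  by (induction A rule: infinite_finite_induct) (auto simp: scaleC_add_right)

lemma scaleC_sum_left: "scaleC (\<Sum>i\<in>A. f i) x = (\<Sum>i\<in>A. scaleC (f i) x)"
  by (induction A rule: infinite_finite_induct) (auto simp: scaleC_add_left)

text \<open>An orthogonal map with square minus the identity is skew-adjoint. This removes the cross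
  terms in \<open>norm_scaleC\<close>.\<close>

lemma inner_jmul_self: "inner x (jmul x) = 0"
  using jmul_inner[of x "jmul x"] by (simp add: jmul_jmul inner_commute)

lemma norm_scaleC: "norm (scaleC c x) = cmod c * norm x"
proof -
  have "inner (scaleC c x) (scaleC c x) = ((Re c)\<^sup>2 + (Im c)\<^sup>2) * inner x x"
    by (simp add: scaleC_def inner_add_left inner_add_right inner_jmul_self jmul_inner
        inner_commute[of "jmul x" x] power2_eq_square algebra_simps)
  then show ?thesis
    by (simp add: norm_eq_sqrt_inner[of x] norm_eq_sqrt_inner[of "scaleC c x"] cmod_def real_sqrt_mult)
qed

lemma scaleC_scaleR: "scaleC c (r *\<^sub>R x) = r *\<^sub>R scaleC c x"
  by (simp add: scaleC_def jmul_scaleR algebra_simps)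

lemma is_bop_add: "is_bop T \<Longrightarrow> T (x + y) = T x + T y"
  unfolding is_bop_def by (simp add: linear_simps)

lemma is_bop_sum: "is_bop T \<Longrightarrow> T (\<Sum>i\<in>A. f i) = (\<Sum>i\<in>A. T (f i))"
  unfolding is_bop_def by (simp add: bounded_linear.linear linear_sum)

lemma is_bop_scaleC: "is_bop T \<Longrightarrow> T (scaleC c x) = scaleC c (T x)"
  unfolding is_bop_def scaleC_def by (simp add: linear_simps)

lemma bounded_linear_scaleC: "bounded_linear (scaleC c)"
proof (rule bounded_linear_intro[where K = "cmod c"])
  show "norm (scaleC c x) \<le> norm x * cmod c" for x :: 'a
    by (simp add: norm_scaleC)
qed (simp_all add: scaleC_add_right scaleC_scaleR)

lemma is_bop_zero_op: "is_bop (\<lambda>h. 0)"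
  by (simp add: is_bop_def)

lemma is_bop_id: "is_bop (\<lambda>h. h)"
  by (simp add: is_bop_def)

lemma is_bop_add_op: "is_bop S \<Longrightarrow> is_bop T \<Longrightarrow> is_bop (\<lambda>h. S h + T h)"
  by (simp add: is_bop_def bounded_linear_add jmul_add)

lemma is_bop_comp: "is_bop S \<Longrightarrow> is_bop T \<Longrightarrow> is_bop (\<lambda>h. S (T h))"
  by (simp add: is_bop_def bounded_linear_compose)

lemma is_bop_scaleC_op: "is_bop T \<Longrightarrow> is_bop (\<lambda>h. scaleC c (T h))"
  unfolding is_bop_def
  using bounded_linear_compose[OF bounded_linear_scaleC, of T c]
  by (auto simp: scaleC_def jmul_add jmul_scaleR)

lemma is_bop_scaleR_op: "is_bop T \<Longrightarrow> is_bop (\<lambda>h. r *\<^sub>R T h)"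
  using is_bop_scaleC_op[of T "of_real r"] by (simp add: scaleC_of_real)

lemma is_bop_sum_op: "(\<And>i. i \<in> A \<Longrightarrow> is_bop (T i)) \<Longrightarrow> is_bop (\<lambda>h. \<Sum>i\<in>A. T i h)"
  by (induction A rule: infinite_finite_induct) (auto simp: is_bop_zero_op is_bop_add_op)

section \<open>Words in operators and homogeneous parts\<close>

lemma word_op_Nil [simp]: "word_op X [] = (\<lambda>h. h)"
  by (auto simp: word_op_def)

lemma word_op_Cons [simp]: "word_op X (i # \<alpha>) = (\<lambda>h. X i (word_op X \<alpha> h))"
  by (auto simp: word_op_def)

lemma is_bop_word_op: "(\<And>i. i \<in> set \<alpha> \<Longrightarrow> is_bop (X i)) \<Longrightarrow> is_bop (word_op X \<alpha>)"
  by (induction \<alpha>) (auto simp: is_bop_id is_bop_comp)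

lemma is_bop_hom_part:
  assumes "\<forall>i<n. is_bop (X i)"
  shows "is_bop (hom_part n a k X)"
  unfolding hom_part_def
  by (intro is_bop_sum_op is_bop_scaleC_op is_bop_word_op) (use assms in \<open>auto simp: words_def\<close>)

lemma word_op_scaleC:
  assumes "\<And>i. i \<in> set \<alpha> \<Longrightarrow> is_bop (X i)"
  shows "word_op (\<lambda>i h. scaleC c (X i h)) \<alpha> h = scaleC (c ^ length \<alpha>) (word_op X \<alpha> h)"
  using assms by (induction \<alpha>) (auto simp: is_bop_scaleC scaleC_scaleC)

text \<open>Every letter contributes one factor \<open>c\<close>, which complex linearity pulls to
  the front. Rotating \<open>X\<close> thereby produces a power series in \<open>c\<close>, the form
  that the averaging lemmas need.\<close>

lemma hom_part_scaleC:
  assumes "\<forall>i<n. is_bop (X i)"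
  shows "hom_part n a k (\<lambda>i h. scaleC c (X i h)) h = scaleC (c ^ k) (hom_part n a k X h)"
proof -
  have "scaleC (a \<alpha>) (word_op (\<lambda>i h. scaleC c (X i h)) \<alpha> h)
      = scaleC (c ^ k) (scaleC (a \<alpha>) (word_op X \<alpha> h))" if "\<alpha> \<in> words n k" for \<alpha>
    using that assms by (subst word_op_scaleC) (auto simp: words_def scaleC_scaleC mult.commute)
  then show ?thesis
    by (simp add: hom_part_def scaleC_sum_right)
qed

lemma finite_words [simp]: "finite (words n k)"
  using finite_lists_length_eq[of "{..<n}" k] by (simp add: words_def conj_commute)

lemma words_0: "words n 0 = {[]}"
  by (auto simp: words_def)

lemma words_Suc: "words n (Suc k) = (\<lambda>(i, \<alpha>). i # \<alpha>) ` ({..<n} \<times> words n k)"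
  by (force simp: words_def length_Suc_conv)

lemma sum_words_Suc: "(\<Sum>\<alpha>\<in>words n (Suc k). f \<alpha>) = (\<Sum>i<n. \<Sum>\<alpha>\<in>words n k. f (i # \<alpha>))"
proof -
  have "inj_on (\<lambda>(i, \<alpha>). i # \<alpha>) ({..<n} \<times> words n k)"
    by (auto simp: inj_on_def)
  then show ?thesis
    by (simp add: words_Suc sum.reindex sum.cartesian_product split_def)
qed

lemma hom_part_0: "hom_part n a 0 X h = scaleC (a []) h"
  by (simp add: hom_part_def words_0)

lemma hom_part_1: "hom_part n a 1 X h = (\<Sum>j<n. scaleC (a [j]) (X j h))"
  unfolding hom_part_def One_nat_def sum_words_Suc by (simp add: words_0)

section \<open>The noncommutative ball as the ball of the row norm\<close>

text \<open>Minimise \<open>\<parallel>x\<parallel>\<^sup>2 / 2 - f x\<close>: minimising sequences are Cauchy by the parallelogram law.\<close>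

lemma riesz_representation:
  fixes f :: "'a::{real_inner,complete_space} \<Rightarrow> real"
  assumes f: "bounded_linear f"
  obtains z where "\<And>x. f x = inner z x"
proof -
  define J where "J x = (norm x)\<^sup>2 / 2 - f x" for x
  interpret f: bounded_linear f by (rule f)
  have lower: "J x \<ge> - (onorm f)\<^sup>2 / 2" for x
  proof -
    have "f x \<le> onorm f * norm x"
      using onorm[OF f, of x] by simp
    moreover have "0 \<le> (norm x - onorm f)\<^sup>2" by simp
    ultimately show ?thesis
      by (simp add: J_def power2_diff algebra_simps)
  qed
  define I where "I = Inf (range J)"
  have bdd: "bdd_below (range J)"
    using lower by (auto intro!: bdd_belowI)
  have I_le: "I \<le> J x" for x
    unfolding I_def by (rule cInf_lower[OF _ bdd]) simp
  have "\<exists>x. J x < I + 1 / real (Suc k)" for k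
  proof -
    have "Inf (range J) < I + 1 / real (Suc k)" by (simp add: I_def)
    then show ?thesis
      using cInf_less_iff[OF _ bdd] by auto
  qed
  then obtain x where x: "\<And>k. J (x k) < I + 1 / real (Suc k)" by metis
  \<comment> \<open>The linear part of \<open>J\<close> cancels at the midpoint, so only the
    parallelogram defect is left, and \<open>J\<close> is at least \<open>I\<close> at the
    midpoint.\<close>
  have par: "(norm (u - v))\<^sup>2 \<le> 4 * (J u - I) + 4 * (J v - I)" for u v
  proof -
    have "J u + J v - 2 * J ((1/2) *\<^sub>R (u + v)) = (norm (u - v))\<^sup>2 / 4"
      by (simp add: J_def f.scaleR f.add power2_norm_eq_inner inner_add_left inner_add_right
          inner_diff_left inner_diff_right inner_commute algebra_simps)
    with I_le[of "(1/2) *\<^sub>R (u + v)"] show ?thesis by simp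
  qed
  have combine: "p < s" if "p \<le> 4 * (b - I) + 4 * (c - I)" "b < I + s / 8" "c < I + s / 8"
    for p b c s :: real
    using that by (simp add: field_simps)
  have "Cauchy x"
  proof (rule CauchyI)
    fix e :: real assume e: "0 < e"
    then obtain M where M: "1 / real (Suc M) < e\<^sup>2 / 8"
      using nat_approx_posE[of "e\<^sup>2 / 8"] by auto
    have "norm (x k - x l) < e" if "k \<ge> M" "l \<ge> M" for k l
    proof -
      have small: "J (x j) < I + e\<^sup>2 / 8" if "j \<ge> M" for j
      proof -
        have "1 / real (Suc j) \<le> 1 / real (Suc M)"
          using that by (intro frac_le) auto
        with M have "1 / real (Suc j) < e\<^sup>2 / 8" by (rule order.strict_trans1[rotated])
        with x[of j] show ?thesis by (meson add_strict_left_mono order.strict_trans)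
      qed
      have "(norm (x k - x l))\<^sup>2 < e\<^sup>2"
        using combine[OF par small[OF that(1)] small[OF that(2)]] .
      then show ?thesis
        using e by (simp add: power_less_imp_less_base)
    qed
    then show "\<exists>M. \<forall>m\<ge>M. \<forall>n\<ge>M. norm (x m - x n) < e" by blast
  qed
  then obtain z where z: "x \<longlonglongrightarrow> z"
    using Cauchy_convergent convergent_def by blast
  have "(\<lambda>k. J (x k)) \<longlonglongrightarrow> J z"
    unfolding J_def by (intro tendsto_intros f.tendsto z) simp
  moreover have "(\<lambda>k. I + 1 / real (Suc k)) \<longlonglongrightarrow> I + 0"
    by (intro tendsto_intros LIMSEQ_Suc[OF lim_1_over_n])
  ultimately have "J z \<le> I + 0"
    by (rule LIMSEQ_le) (use x less_imp_le in blast)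
  then have min: "J z \<le> J y" for y
    using I_le[of y] by linarith
  have "f y = inner z y" for y
  proof -
    define d where "d = f y - inner z y"
    have q: "2 * t * d \<le> t\<^sup>2 * inner y y" for t
    proof -
      have "(norm (z + t *\<^sub>R y))\<^sup>2 = (norm z)\<^sup>2 + 2 * t * inner z y + t\<^sup>2 * inner y y"
        unfolding power2_norm_eq_inner
        by (simp add: inner_add_left inner_add_right inner_commute power2_eq_square algebra_simps)
      then show ?thesis
        using min[of "z + t *\<^sub>R y"] by (simp add: J_def d_def f.scaleR f.add algebra_simps)
    qed
    have "d = 0"
    proof (rule ccontr)
      assume d: "d \<noteq> 0"
      \<comment> \<open>Adding 1 keeps the divisor positive even for \<open>y = 0\<close>. The
        choice \<open>t = d / c\<close> in \<open>q\<close> then gives twice the square of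
        \<open>d\<close> on the left and at most that square on the right.\<close>
      define c where "c = inner y y + 1"
      have c: "c > 0" by (simp add: c_def add_nonneg_pos)
      have "2 * (d / c) * d \<le> (d / c)\<^sup>2 * c"
        using q[of "d / c"] by (simp add: c_def algebra_simps add_increasing)
      then have "2 * d\<^sup>2 \<le> d\<^sup>2"
        using c by (simp add: field_simps power2_eq_square)
      with d show False by simp
    qed
    then show ?thesis by (simp add: d_def)
  qed
  then show ?thesis using that by blast
qed

text \<open>\<open>adjoint\<close> is a choice operator, so its characteristic identity holds once
  some adjoint exists. Riesz representation of \<open>x \<mapsto> inner (T x) y\<close> supplies
  one.\<close>

lemma inner_adjoint_hilbert:
  fixes T :: "'a::{real_inner,complete_space} \<Rightarrow> 'a"
  assumes T: "bounded_linear T"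
  shows "inner (T x) y = inner x (adjoint T y)"
proof -
  have "\<exists>z. \<forall>x. inner (T x) y = inner x z" for y
  proof -
    have "bounded_linear (\<lambda>x. inner (T x) y)"
      using T by (rule bounded_linear_inner_left_comp)
    then obtain z where "\<And>x. inner (T x) y = inner z x"
      by (rule riesz_representation) blast
    then show ?thesis by (auto simp: inner_commute)
  qed
  then obtain T' where "\<forall>x y. inner (T x) y = inner x (T' y)" by metis
  then have "\<forall>x y. inner (T x) y = inner x (adjoint T y)"
    
    unfolding adjoint_def by (rule someI[where P = "\<lambda>f'. \<forall>x y. inner (T x) y = inner x (f' y)"])
  then show ?thesis by blast
qed

lemma bounded_linear_adjoint_hilbert:
  fixes T :: "'a::{real_inner,complete_space} \<Rightarrow> 'a"
  assumes T: "bounded_linear T"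
  shows "bounded_linear (adjoint T)"
proof (rule bounded_linear_intro[where K = "onorm T"])
  note adj = inner_adjoint_hilbert[OF T]
  show "adjoint T (x + y) = adjoint T x + adjoint T y" for x y
    by (subst vector_eq_ldot[symmetric]) (simp add: adj[symmetric] inner_add_right)
  show "adjoint T (r *\<^sub>R x) = r *\<^sub>R adjoint T x" for r x
    by (subst vector_eq_ldot[symmetric]) (simp add: adj[symmetric])
  show "norm (adjoint T x) \<le> norm x * onorm T" for x
  proof -
    let ?y = "adjoint T x"
    have "(norm ?y)\<^sup>2 = inner (T ?y) x"
      by (simp add: adj power2_norm_eq_inner)
    also have "\<dots> \<le> norm (T ?y) * norm x"
      by (rule norm_cauchy_schwarz)
    also have "\<dots> \<le> (onorm T * norm ?y) * norm x"
      by (intro mult_right_mono onorm T) auto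
    finally show ?thesis
      using onorm_pos_le[OF T]
      by (cases "norm ?y = 0") (auto simp: power2_eq_square algebra_simps)
  qed
qed

text \<open>The operator norm bound for the row \<open>[X 0, ..., X (n - 1)]\<close> on the n-fold
  Hilbert sum, whose norm is written with \<open>L2_set\<close>. Unlike \<open>nc_ball\<close> it
  involves no adjoints, and it is visibly stable under rotations, averages and pointwise
  limits.\<close>

definition row_bounded :: "nat \<Rightarrow> real \<Rightarrow> (nat \<Rightarrow> 'a::real_normed_vector \<Rightarrow> 'a) \<Rightarrow> bool" where
  "row_bounded n r X \<longleftrightarrow>
     (\<forall>h. norm (\<Sum>i<n. X i (h i)) \<le> r * L2_set (\<lambda>i. norm (h i)) {..<n})"

text \<open>With \<open>T\<close> the sum of the \<open>X i (adjoint (X i))\<close>,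
  \<open>inner (T v) v\<close> is the squared norm of the column of adjoints at \<open>v\<close>, so
  that column is bounded by \<open>r = sqrt (onorm T)\<close>. Pairing
  \<open>v = (\<Sum>i<n. X i (h i))\<close> with itself transfers the bound to the row.\<close>

lemma nc_ball_imp_row_bounded:
  fixes X :: "nat \<Rightarrow> 'a::complex_hilbert \<Rightarrow> 'a"
  assumes X: "X \<in> nc_ball n \<gamma>"
  obtains r where "0 \<le> r" "r < \<gamma>" "row_bounded n r X"
proof -
  define T where "T h = (\<Sum>i<n. X i (adjoint (X i) h))" for h
  define r where "r = sqrt (onorm T)"
  have bop: "bounded_linear (X i)" if "i < n" for i
    using X that by (auto simp: nc_ball_def is_bop_def)
  note adj = inner_adjoint_hilbert[OF bop] and bl = bounded_linear_adjoint_hilbert[OF bop]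
  have T: "bounded_linear T"
    unfolding T_def
    by (intro bounded_linear_sum) (auto intro: bounded_linear_compose[OF bop bl])
  have r: "0 \<le> r" "r < \<gamma>"
    using X onorm_pos_le[OF T] by (auto simp: r_def nc_ball_def T_def[abs_def])
  have T_inner: "(L2_set (\<lambda>i. norm (adjoint (X i) v)) {..<n})\<^sup>2 = inner (T v) v" for v
    by (simp add: L2_set_def sum_nonneg T_def inner_sum_left adj power2_norm_eq_inner)
  have "norm (\<Sum>i<n. X i (h i)) \<le> r * L2_set (\<lambda>i. norm (h i)) {..<n}" for h
  proof -
    define v where "v = (\<Sum>i<n. X i (h i))"
    let ?L = "L2_set (\<lambda>i. norm (h i)) {..<n}"
    have "L2_set (\<lambda>i. norm (adjoint (X i) v)) {..<n} \<le> r * norm v"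
    proof (rule power2_le_imp_le)
      have "inner (T v) v \<le> norm (T v) * norm v" by (rule norm_cauchy_schwarz)
      also have "\<dots> \<le> (onorm T * norm v) * norm v"
        by (intro mult_right_mono onorm T) auto
      also have "\<dots> = (r * norm v)\<^sup>2"
        using onorm_pos_le[OF T] by (simp add: r_def power_mult_distrib power2_eq_square)
      finally show "(L2_set (\<lambda>i. norm (adjoint (X i) v)) {..<n})\<^sup>2 \<le> (r * norm v)\<^sup>2"
        by (simp add: T_inner)
    qed (use r in simp)
    moreover have "(norm v)\<^sup>2 = (\<Sum>i<n. inner (h i) (adjoint (X i) v))"
      by (simp add: power2_norm_eq_inner) (simp add: v_def inner_sum_left adj)
    moreover have "\<dots> \<le> (\<Sum>i<n. \<bar>norm (h i)\<bar> * \<bar>norm (adjoint (X i) v)\<bar>)"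
      by (intro sum_mono) (simp add: norm_cauchy_schwarz)
    moreover have "\<dots> \<le> ?L * L2_set (\<lambda>i. norm (adjoint (X i) v)) {..<n}"
      by (rule L2_set_mult_ineq)
    ultimately have "(norm v)\<^sup>2 \<le> ?L * (r * norm v)"
      using mult_left_mono[of _ "r * norm v" ?L] L2_set_nonneg[of "\<lambda>i. norm (h i)" "{..<n}"]
      by fastforce
    then show ?thesis
      unfolding v_def[symmetric] using r
      by (cases "norm v = 0") (auto simp: power2_eq_square algebra_simps L2_set_nonneg)
  qed
  then show ?thesis
    using that r by (auto simp: row_bounded_def)
qed

text \<open>Testing the row bound on \<open>h i = adjoint (X i) v\<close> bounds the square of
  \<open>norm (T v)\<close> by \<open>inner (T v) v\<close> times the square of \<open>r\<close>.
  Cauchy-Schwarz then lets one factor \<open>norm (T v)\<close> cancel.\<close>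

lemma row_bounded_imp_nc_ball:
  fixes X :: "nat \<Rightarrow> 'a::complex_hilbert \<Rightarrow> 'a"
  assumes X: "\<forall>i<n. is_bop (X i)" and row: "row_bounded n r X" and r: "0 \<le> r" "r < \<gamma>"
  shows "X \<in> nc_ball n \<gamma>"
proof -
  define T where "T h = (\<Sum>i<n. X i (adjoint (X i) h))" for h
  have bop: "bounded_linear (X i)" if "i < n" for i
    using X that by (auto simp: is_bop_def)
  note adj = inner_adjoint_hilbert[OF bop]
  have T_inner: "(L2_set (\<lambda>i. norm (adjoint (X i) v)) {..<n})\<^sup>2 = inner (T v) v" for v
    by (simp add: L2_set_def sum_nonneg T_def inner_sum_left adj power2_norm_eq_inner)
  have "norm (T v) \<le> r\<^sup>2 * norm v" for v
  proof -
    have "norm (T v) \<le> r * L2_set (\<lambda>i. norm (adjoint (X i) v)) {..<n}"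
      using row by (simp add: row_bounded_def T_def)
    then have "(norm (T v))\<^sup>2 \<le> (r * L2_set (\<lambda>i. norm (adjoint (X i) v)) {..<n})\<^sup>2"
      by (rule power_mono) simp
    also have "\<dots> = r\<^sup>2 * inner (T v) v"
      by (simp add: power_mult_distrib T_inner)
    also have "\<dots> \<le> r\<^sup>2 * (norm (T v) * norm v)"
      by (intro mult_left_mono norm_cauchy_schwarz) simp
    finally show ?thesis
      by (cases "norm (T v) = 0") (auto simp: power2_eq_square algebra_simps r(1))
  qed
  then have "onorm T \<le> r\<^sup>2"
    by (intro onorm_bound) auto
  then have "sqrt (onorm T) \<le> r"
    using r by (simp add: real_le_lsqrt)
  then show ?thesis
    using X r by (auto simp: nc_ball_def T_def[abs_def])
qed

section \<open>Norm estimates for homogeneous parts and convergence of the series\<close>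

lemma row_bounded_scaleC:
  assumes "row_bounded n r X"
  shows "row_bounded n (cmod c * r) (\<lambda>i h. scaleC c (X i h))"
  using assms unfolding row_bounded_def
  by (auto simp: scaleC_sum_right[symmetric] norm_scaleC mult.assoc intro!: mult_left_mono)

lemma row_bounded_component:
  assumes row: "row_bounded n r X" and X: "\<forall>i<n. is_bop (X i)" and i: "i < n"
  shows "norm (X i h) \<le> r * norm h"
proof -
  let ?h = "\<lambda>j. if j = i then h else 0"
  have "X j (?h j) = (if j = i then X i h else 0)" if "j < n" for j
    using is_bop_scaleC[of "X j" 0 0] X that by auto
  then have "(\<Sum>j<n. X j (?h j)) = (\<Sum>j<n. if j = i then X i h else 0)"
    by (intro sum.cong) auto
  then have "(\<Sum>j<n. X j (?h j)) = X i h"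
    using i by simp
  moreover have "(\<lambda>j. (norm (?h j))\<^sup>2) = (\<lambda>j. if j = i then (norm h)\<^sup>2 else 0)" by auto
  then have "L2_set (\<lambda>j. norm (?h j)) {..<n} = norm h"
    using i unfolding L2_set_def by (simp only:) simp
  ultimately show ?thesis
    using row[unfolded row_bounded_def, rule_format, of ?h] by simp
qed

text \<open>The row of all words of length \<open>k\<close> is a k-fold composite of the row
  \<open>X\<close> (amplified to the blocks), so its norm is at most \<open>r ^ k\<close> however
  many words there are. The induction splits off the first letter.\<close>

lemma row_bounded_words:
  assumes row: "row_bounded n r X" and r: "0 \<le> r" and X: "\<forall>i<n. is_bop (X i)"
  shows "norm (\<Sum>\<alpha>\<in>words n k. word_op X \<alpha> (h \<alpha>)) \<le> r ^ k * L2_set (\<lambda>\<alpha>. norm (h \<alpha>)) (words n k)"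
proof (induction k arbitrary: h)
  case 0
  then show ?case by (simp add: words_0 L2_set_def)
next
  case (Suc k)
  let ?w = "\<lambda>i. \<Sum>\<alpha>\<in>words n k. word_op X \<alpha> (h (i # \<alpha>))"
  let ?L = "\<lambda>i. L2_set (\<lambda>\<alpha>. norm (h (i # \<alpha>))) (words n k)"
  have "(\<Sum>\<alpha>\<in>words n (Suc k). word_op X \<alpha> (h \<alpha>)) = (\<Sum>i<n. X i (?w i))"
    unfolding sum_words_Suc by (intro sum.cong) (use X in \<open>auto simp: is_bop_sum\<close>)
  also have "norm \<dots> \<le> r * L2_set (\<lambda>i. norm (?w i)) {..<n}"
    using row by (simp add: row_bounded_def)
  also have "\<dots> \<le> r * L2_set (\<lambda>i. r ^ k * ?L i) {..<n}"
    by (intro mult_left_mono L2_set_mono Suc r) simp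
  also have "\<dots> = r ^ Suc k * L2_set ?L {..<n}"
    using r by (simp add: L2_set_right_distrib[symmetric])
  also have "L2_set ?L {..<n} = L2_set (\<lambda>\<alpha>. norm (h \<alpha>)) (words n (Suc k))"
    unfolding L2_set_def sum_words_Suc by (simp add: sum_nonneg)
  finally show ?case .
qed

text \<open>Moving the coefficients onto the vector makes the input tuple
  \<open>scaleC (a \<alpha>) h\<close>, whose norm is \<open>norm h\<close> times the l2 norm of the
  coefficients, the very quantity in \<open>free_holomorphic\<close>.\<close>

lemma norm_hom_part_le:
  assumes "row_bounded n r X" "0 \<le> r" "\<forall>i<n. is_bop (X i)"
  shows "norm (hom_part n a k X h) \<le> r ^ k * sqrt (\<Sum>\<alpha>\<in>words n k. (cmod (a \<alpha>))\<^sup>2) * norm h"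
proof -
  have "hom_part n a k X h = (\<Sum>\<alpha>\<in>words n k. word_op X \<alpha> (scaleC (a \<alpha>) h))"
    unfolding hom_part_def
    by (intro sum.cong refl is_bop_scaleC[symmetric] is_bop_word_op)
      (use assms in \<open>auto simp: words_def\<close>)
  also have "norm \<dots> \<le> r ^ k * L2_set (\<lambda>\<alpha>. norm h * cmod (a \<alpha>)) (words n k)"
    using row_bounded_words[OF assms, where h = "\<lambda>\<alpha>. scaleC (a \<alpha>) h"]
    by (simp add: norm_scaleC mult.commute)
  also have "L2_set (\<lambda>\<alpha>. norm h * cmod (a \<alpha>)) (words n k)
      = norm h * sqrt (\<Sum>\<alpha>\<in>words n k. (cmod (a \<alpha>))\<^sup>2)"
    by (subst L2_set_right_distrib[symmetric]) (simp_all add: L2_set_def)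
  finally show ?thesis by (simp add: algebra_simps)
qed

text \<open>Root test: for \<open>\<rho>\<close> strictly between \<open>r\<close> and
  \<open>\<gamma>\<close> the terms are eventually dominated by a geometric series of ratio
  \<open>r / \<rho>\<close>.\<close>

lemma summable_norm_hom_part:
  assumes holo: "free_holomorphic n \<gamma> a" and row: "row_bounded n r X" and r: "0 \<le> r" "r < \<gamma>"
    and X: "\<forall>i<n. is_bop (X i)"
  shows "summable (\<lambda>k. norm (hom_part n a k X h))"
proof -
  define A where "A k = (\<Sum>\<alpha>\<in>words n k. (cmod (a \<alpha>))\<^sup>2)" for k
  have A0: "A k \<ge> 0" for k by (simp add: A_def sum_nonneg)
  obtain \<rho> where \<rho>: "r < \<rho>" "\<rho> < \<gamma>" using r dense by blast
  have "1 / \<gamma> < 1 / \<rho>" using r \<rho> by (simp add: frac_less2)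
  then have "limsup (\<lambda>k. ereal (A k powr (1 / (2 * real k)))) < ereal (1 / \<rho>)"
    using holo unfolding free_holomorphic_def A_def
    by (meson ereal_less(1) less_ereal.simps(1) order.strict_trans1)
  then have "\<forall>\<^sub>F k in sequentially. ereal (A k powr (1 / (2 * real k))) < ereal (1 / \<rho>)"
    by (rule Limsup_lessD)
  then have ev: "\<forall>\<^sub>F k in sequentially. norm (norm (hom_part n a k X h)) \<le> norm h * (r / \<rho>) ^ k"
    \<comment> \<open>At \<open>k = 0\<close> the exponent \<open>1 / (2 * real k)\<close> is 0 by
      convention, and the power could not be undone.\<close>
    using eventually_gt_at_top[of 0]
  proof eventually_elim
    case (elim k)
    have "A k = (A k powr (1 / (2 * real k))) powr (2 * real k)"
      using elim A0[of k] by (simp add: powr_powr)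
    also have "\<dots> \<le> (1 / \<rho>) powr (2 * real k)"
      by (rule powr_mono2) (use elim in auto)
    also have "\<dots> = ((1 / \<rho>) ^ k)\<^sup>2"
      using \<rho> r powr_realpow[of "1 / \<rho>" "2 * k"] by (simp add: power_mult[symmetric] mult.commute)
    finally have "sqrt (A k) \<le> (1 / \<rho>) ^ k"
      using \<rho> r by (simp add: real_le_lsqrt)
    then have "r ^ k * sqrt (A k) * norm h \<le> r ^ k * (1 / \<rho>) ^ k * norm h"
      using r by (intro mult_right_mono mult_left_mono) auto
    with norm_hom_part_le[OF row r(1) X, of a k h] show ?case
      by (simp add: A_def power_divide algebra_simps)
  qed
  have "summable (\<lambda>k. norm h * (r / \<rho>) ^ k)"
    using r \<rho> by (intro summable_mult summable_geometric) auto
  then show ?thesis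
    by (rule summable_comparison_test_ev[OF ev])
qed

section \<open>Coefficient bounds for vector-valued polynomials\<close>

text \<open>A geometric sum; the bound on \<open>t\<close> leaves 0 as the only multiple of
  \<open>M\<close>.\<close>

lemma sum_roots_of_unity:
  fixes t :: int
  assumes t: "\<bar>t\<bar> < int M"
  shows "(\<Sum>j<M. cis (2 * pi * real j * of_int t / real M)) = (if t = 0 then of_nat M else 0)"
proof (cases "t = 0")
  case False
  define z where "z = cis (2 * pi * of_int t / real M)"
  have M: "M > 0" using t by (cases M) auto
  have pow: "cis (2 * pi * real j * of_int t / real M) = z ^ j" for j
    by (simp add: z_def Complex.DeMoivre algebra_simps)
  have "z \<noteq> 1"
  proof
    assume "z = 1"
    then have "cos (2 * pi * of_int t / real M) = 1"
      by (simp add: z_def complex_eq_iff)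
    then obtain q :: int where "2 * pi * of_int t / real M = of_int q * 2 * pi"
      by (auto simp: cos_one_2pi_int)
    then have "real_of_int t = real_of_int (q * int M)"
      using M by (simp add: field_simps)
    then have "t = q * int M" by (simp only: of_int_eq_iff)
    with t False show False
      by (auto simp: abs_mult)
  qed
  moreover have "z ^ M = 1"
    using M by (simp add: z_def Complex.DeMoivre cis_multiple_2pi)
  ultimately show ?thesis
    using False unfolding pow by (simp add: geometric_sum)
qed simp

text \<open>Discrete Fourier inversion: finitely many equidistant nodes replace the integral over
  the circle. The frequency \<open>p\<close> is an integer because the negative value
  \<open>2 - m\<close> occurs below.\<close>

lemma circle_average:
  fixes v :: "nat \<Rightarrow> 'a::complex_hilbert" and p :: int
  assumes p: "\<And>k. k < K \<Longrightarrow> \<bar>int k - p\<bar> < int M"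
  shows "(\<Sum>j<M. scaleC (cis (- (2 * pi * real j * of_int p / real M)))
            (\<Sum>k<K. scaleC (cis (2 * pi * real j / real M) ^ k) (v k)))
       = real M *\<^sub>R (if 0 \<le> p \<and> p < int K then v (nat p) else 0)"
proof -
  have "(\<Sum>j<M. scaleC (cis (- (2 * pi * real j * of_int p / real M)))
            (\<Sum>k<K. scaleC (cis (2 * pi * real j / real M) ^ k) (v k)))
     = (\<Sum>j<M. \<Sum>k<K. scaleC (cis (2 * pi * real j * of_int (int k - p) / real M)) (v k))"
    by (simp add: scaleC_sum_right scaleC_scaleC Complex.DeMoivre cis_mult algebra_simps diff_divide_distrib)
  also have "\<dots> = (\<Sum>k<K. scaleC (\<Sum>j<M. cis (2 * pi * real j * of_int (int k - p) / real M)) (v k))"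
    unfolding scaleC_sum_left by (rule sum.swap)
  also have "\<dots> = (\<Sum>k<K. if int k = p then real M *\<^sub>R v k else 0)"
    by (intro sum.cong refl, subst sum_roots_of_unity)
      (use p scaleC_of_real[of "real M"] in \<open>auto\<close>)
  also have "\<dots> = (\<Sum>k<K. if k = nat p \<and> 0 \<le> p then real M *\<^sub>R v k else 0)"
    by (intro sum.cong) auto
  also have "\<dots> = real M *\<^sub>R (if 0 \<le> p \<and> p < int K then v (nat p) else 0)"
    by (cases "0 \<le> p") (auto simp: nat_less_iff)
  finally show ?thesis .
qed

text \<open>The Cauchy estimate with the \<open>K\<close>-th roots of unity as nodes:
  \<open>v m\<close> is a mean of unimodular multiples of the values there.\<close>

lemma cauchy_coefficient_bound:
  fixes v :: "nat \<Rightarrow> 'a::complex_hilbert"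
  assumes B: "\<And>c. cmod c = 1 \<Longrightarrow> norm (\<Sum>k<K. scaleC (c ^ k) (v k)) \<le> B" and m: "m < K"
  shows "norm (v m) \<le> B"
proof -
  have "real K *\<^sub>R v m = (\<Sum>j<K. scaleC (cis (- (2 * pi * real j * of_int (int m) / real K)))
            (\<Sum>k<K. scaleC (cis (2 * pi * real j / real K) ^ k) (v k)))"
    using m by (subst circle_average) auto
  also have "norm \<dots> \<le> (\<Sum>j<K. B)"
    by (intro sum_norm_le) (simp add: norm_scaleC B)
  finally show ?thesis
    using m by simp
qed

text \<open>The kernel \<open>1 + cos ((m - 1) \<theta>)\<close> is nonnegative with mean one, and after division by
  \<open>e\<^sup>i\<^sup>\<theta>\<close> picks out the coefficients of index \<open>1\<close>, \<open>m\<close> and \<open>2 - m\<close>.\<close>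

lemma fejer_coefficient_bound:
  fixes v :: "nat \<Rightarrow> 'a::complex_hilbert"
  assumes B: "\<And>c. cmod c = 1 \<Longrightarrow> norm (\<Sum>k<K. scaleC (c ^ k) (v k)) \<le> B"
    and m: "2 \<le> m" "m < K" and v0: "v 0 = 0"
  shows "norm (v 1 + (1/2) *\<^sub>R v m) \<le> B"
proof -
  \<comment> \<open>The differences \<open>k - (2 - m)\<close> can be as large as
    \<open>2 * K - 4\<close>, so \<open>2 * K\<close> nodes exclude aliasing.\<close>
  define M where "M = 2 * K"
  define \<theta> where "\<theta> j = 2 * pi * real j / real M" for j
  define V where "V j = (\<Sum>k<K. scaleC (cis (\<theta> j) ^ k) (v k))" for j
  define w where "w j = 1 + cos (real (m - 1) * \<theta> j)" for j
  have M: "M > 0" using m by (simp add: M_def)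
  have avg: "(\<Sum>j<M. scaleC (cis (- (of_int p * \<theta> j))) (V j))
       = real M *\<^sub>R (if 0 \<le> p \<and> p < int K then v (nat p) else 0)"
    if "\<And>k. k < K \<Longrightarrow> \<bar>int k - p\<bar> < int M" for p
    using circle_average[OF that, of K v] by (simp add: V_def \<theta>_def mult_ac)
  have kernel: "complex_of_real (w j) * cis (- \<theta> j) = cis (- (of_int 1 * \<theta> j))
      + of_real (1/2) * cis (- (of_int (2 - int m) * \<theta> j))
      + of_real (1/2) * cis (- (of_int (int m) * \<theta> j))" for j
  proof -
    define \<phi> where "\<phi> = real (m - 1) * \<theta> j"
    have "complex_of_real (w j) = 1 + of_real (1/2) * cis \<phi> + of_real (1/2) * cis (- \<phi>)"
      by (simp add: w_def \<phi>_def complex_eq_iff)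
    moreover have "cis (- (of_int (2 - int m) * \<theta> j)) = cis \<phi> * cis (- \<theta> j)"
      "cis (- (of_int (int m) * \<theta> j)) = cis (- \<phi>) * cis (- \<theta> j)"
      using m by (simp_all add: cis_mult \<phi>_def of_nat_diff algebra_simps)
    ultimately show ?thesis by (simp add: algebra_simps)
  qed
  have "(\<Sum>j<M. scaleC (of_real (w j) * cis (- \<theta> j)) (V j))
      = real M *\<^sub>R v 1 + (1/2) *\<^sub>R (\<Sum>j<M. scaleC (cis (- (of_int (2 - int m) * \<theta> j))) (V j))
        + (1/2) *\<^sub>R (real M *\<^sub>R v m)"
    using avg[of 1] avg[of "int m"] m
    unfolding kernel scaleC_add_left scaleC_scaleC[symmetric] scaleC_of_real sum.distrib
      scaleR_sum_right[symmetric]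
    by (auto simp: M_def)
  \<comment> \<open>The index \<open>2 - m\<close> is negative for \<open>m > 2\<close>; for
    \<open>m = 2\<close> it is 0 and the hypothesis \<open>v 0 = 0\<close> enters.\<close>
  also have "(\<Sum>j<M. scaleC (cis (- (of_int (2 - int m) * \<theta> j))) (V j)) = 0"
    by (subst avg) (use m v0 in \<open>auto simp: M_def\<close>)
  finally have "real M *\<^sub>R (v 1 + (1/2) *\<^sub>R v m)
      = (\<Sum>j<M. scaleC (of_real (w j) * cis (- \<theta> j)) (V j))"
    by (simp add: algebra_simps)
  also have "norm \<dots> \<le> (\<Sum>j<M. w j * B)"
  proof (intro sum_norm_le)
    fix j
    have "w j \<ge> 0"
      using cos_ge_minus_one[of "real (m - 1) * \<theta> j"] unfolding w_def by linarith
    then show "norm (scaleC (of_real (w j) * cis (- \<theta> j)) (V j)) \<le> w j * B"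
      using B[of "cis (\<theta> j)"] by (simp add: norm_scaleC norm_mult V_def mult_left_mono)
  qed
  also have "\<dots> = (\<Sum>j<M. w j) * B"
    by (simp add: sum_distrib_right)
  \<comment> \<open>Since \<open>0 < m - 1 < M\<close>, the cosine has mean zero over the
    nodes.\<close>
  also have "(\<Sum>j<M. w j) = real M"
  proof -
    have "(\<Sum>j<M. cis (2 * pi * real j * of_int (int (m - 1)) / real M)) = 0"
      using m by (subst sum_roots_of_unity) (auto simp: M_def)
    then have "(\<Sum>j<M. cos (2 * pi * real j * of_int (int (m - 1)) / real M)) = 0"
      by (simp add: complex_eq_iff)
    then show ?thesis
      by (simp add: w_def \<theta>_def sum.distrib mult_ac)
  qed
  finally show ?thesis
    using M by simp
qed

text \<open>For \<open>cmod c = 1\<close> the norms of the terms do not depend on \<open>c\<close>,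
  so cutting off the tail costs at most \<open>e\<close> uniformly on the circle. The polynomial
  case applies with \<open>B + e\<close>.\<close>

lemma fejer_coefficient_bound_series:
  fixes v :: "nat \<Rightarrow> 'a::complex_hilbert"
  assumes sm: "summable (\<lambda>k. norm (v k))"
    and B: "\<And>c. cmod c = 1 \<Longrightarrow> norm (\<Sum>k. scaleC (c ^ k) (v k)) \<le> B"
    and m: "2 \<le> m" and v0: "v 0 = 0"
  shows "norm (v 1 + (1/2) *\<^sub>R v m) \<le> B"
proof (rule field_le_epsilon)
  fix e :: real assume "e > 0"
  then obtain N where N: "\<And>K. K \<ge> N \<Longrightarrow> norm (\<Sum>k. norm (v (k + K))) < e"
    using suminf_exist_split[OF _ sm] by blast
  define K where "K = max N (Suc m)"
  show "norm (v 1 + (1/2) *\<^sub>R v m) \<le> B + e"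
  proof (rule fejer_coefficient_bound[where K = K and v = v, OF _ m _ v0])
    fix c :: complex assume c: "cmod c = 1"
    have nrm: "norm (scaleC (c ^ k) (v k)) = norm (v k)" for k
      using c by (simp add: norm_scaleC norm_power)
    have sc: "summable (\<lambda>k. scaleC (c ^ k) (v k))"
      by (rule summable_norm_cancel) (simp add: nrm sm)
    have "(\<Sum>k<K. scaleC (c ^ k) (v k))
        = (\<Sum>k. scaleC (c ^ k) (v k)) - (\<Sum>k. scaleC (c ^ (k + K)) (v (k + K)))"
      using suminf_split_initial_segment[OF sc, of K] by simp
    also have "norm \<dots> \<le> norm (\<Sum>k. scaleC (c ^ k) (v k))
        + norm (\<Sum>k. scaleC (c ^ (k + K)) (v (k + K)))"
      by (rule norm_triangle_ineq4)
    also have "norm (\<Sum>k. scaleC (c ^ (k + K)) (v (k + K))) \<le> (\<Sum>k. norm (v (k + K)))"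
      using summable_norm[of "\<lambda>k. scaleC (c ^ (k + K)) (v (k + K))"]
        summable_ignore_initial_segment[OF sm, of K]
      by (simp only: nrm)
    also have "\<dots> \<le> e"
      using N[of K] by (simp add: K_def)
    finally show "norm (\<Sum>k<K. scaleC (c ^ k) (v k)) \<le> B + e"
      using B[OF c] by simp
  qed (simp add: K_def)
qed

section \<open>Operator polynomials in one complex parameter\<close>

definition vpoly :: "(complex \<Rightarrow> 'a::complex_hilbert) \<Rightarrow> bool" where
  "vpoly f \<longleftrightarrow> (\<exists>K v. \<forall>c. f c = (\<Sum>k<K. scaleC (c ^ k) (v k)))"

text \<open>Polynomial dependence is expressed by preservation of \<^const>\<open>vpoly\<close>, which makes closure
  under composition immediate and avoids Cauchy products of operator coefficients.\<close>

definition opoly :: "(complex \<Rightarrow> 'a \<Rightarrow> 'a::complex_hilbert) \<Rightarrow> bool" where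
  "opoly \<Phi> \<longleftrightarrow> (\<forall>c. is_bop (\<Phi> c)) \<and> (\<forall>f. vpoly f \<longrightarrow> vpoly (\<lambda>c. \<Phi> c (f c)))"

lemma vpoly_const: "vpoly (\<lambda>c. x)"
  unfolding vpoly_def by (rule exI[of _ 1]) (auto intro!: exI[of _ "\<lambda>k. x"])

lemma vpoly_add:
  assumes "vpoly f" "vpoly g"
  shows "vpoly (\<lambda>c. f c + g c)"
proof -
  obtain K v where f: "\<And>c. f c = (\<Sum>k<K. scaleC (c ^ k) (v k))"
    using assms(1) unfolding vpoly_def by blast
  obtain L w where g: "\<And>c. g c = (\<Sum>k<L. scaleC (c ^ k) (w k))"
    using assms(2) unfolding vpoly_def by blast
  let ?N = "max K L"
  have ext: "(\<Sum>k<J. scaleC (c ^ k) (u k)) = (\<Sum>k<?N. scaleC (c ^ k) (if k < J then u k else 0))"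
    if "J \<le> ?N" for J c and u :: "nat \<Rightarrow> 'a"
    using that by (intro sum.mono_neutral_cong_left) auto
  have eq: "f c + g c = (\<Sum>k<?N. scaleC (c ^ k) ((if k < K then v k else 0) + (if k < L then w k else 0)))" for c
    unfolding f g scaleC_add_right sum.distrib
    by (subst ext[of K], simp, subst ext[of L], simp, rule refl)
  show ?thesis
    unfolding vpoly_def by (intro exI allI) (rule eq)
qed

lemma vpoly_bop:
  assumes "is_bop T" "vpoly f"
  shows "vpoly (\<lambda>c. T (f c))"
proof -
  obtain K v where f: "\<And>c. f c = (\<Sum>k<K. scaleC (c ^ k) (v k))"
    using assms(2) unfolding vpoly_def by blast
  have eq: "T (f c) = (\<Sum>k<K. scaleC (c ^ k) (T (v k)))" for c
    using assms(1) by (simp add: f is_bop_sum is_bop_scaleC)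
  show ?thesis
    unfolding vpoly_def by (intro exI allI) (rule eq)
qed

lemma vpoly_shift:
  assumes "vpoly f"
  shows "vpoly (\<lambda>c. scaleC c (f c))"
proof -
  obtain K v where f: "\<And>c. f c = (\<Sum>k<K. scaleC (c ^ k) (v k))"
    using assms unfolding vpoly_def by blast
  have eq: "scaleC c (f c) = (\<Sum>k<Suc K. scaleC (c ^ k) (case k of 0 \<Rightarrow> 0 | Suc l \<Rightarrow> v l))" for c
    unfolding f sum.lessThan_Suc_shift by (simp add: scaleC_sum_right scaleC_scaleC)
  show ?thesis
    unfolding vpoly_def by (intro exI allI) (rule eq)
qed

lemma opoly_is_bop: "opoly \<Phi> \<Longrightarrow> is_bop (\<Phi> c)"
  by (simp add: opoly_def)

lemma opoly_const: "is_bop T \<Longrightarrow> opoly (\<lambda>c. T)"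
  by (simp add: opoly_def vpoly_bop)

lemma opoly_add: "opoly \<Phi> \<Longrightarrow> opoly \<Psi> \<Longrightarrow> opoly (\<lambda>c h. \<Phi> c h + \<Psi> c h)"
  by (simp add: opoly_def vpoly_add is_bop_add_op)

lemma opoly_comp: "opoly \<Phi> \<Longrightarrow> opoly \<Psi> \<Longrightarrow> opoly (\<lambda>c h. \<Phi> c (\<Psi> c h))"
  by (simp add: opoly_def is_bop_comp)

lemma opoly_shift: "opoly \<Phi> \<Longrightarrow> opoly (\<lambda>c h. scaleC c (\<Phi> c h))"
  by (simp add: opoly_def vpoly_shift is_bop_scaleC_op)

lemma opoly_scaleC: "opoly \<Phi> \<Longrightarrow> opoly (\<lambda>c h. scaleC d (\<Phi> c h))"
  using opoly_comp[OF opoly_const[OF is_bop_scaleC_op[OF is_bop_id]]] .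

lemma opoly_sum: "(\<And>i. i \<in> A \<Longrightarrow> opoly (\<Phi> i)) \<Longrightarrow> opoly (\<lambda>c h. \<Sum>i\<in>A. \<Phi> i c h)"
  by (induction A rule: infinite_finite_induct)
    (auto intro: opoly_add simp: opoly_const is_bop_zero_op)

lemma opoly_power_shift: "opoly \<Phi> \<Longrightarrow> opoly (\<lambda>c h. scaleC (c ^ k) (\<Phi> c h))"
proof (induction k)
  case (Suc k)
  then show ?case
    using opoly_shift[of "\<lambda>c h. scaleC (c ^ k) (\<Phi> c h)"] by (simp add: scaleC_scaleC)
qed simp

text \<open>Each letter is \<open>c X\<close> up to order \<open>c ^ 2\<close>, so a word has
  leading term \<open>c ^ length \<alpha>\<close> times the word in \<open>X\<close>. The remainder
  is divisible by one more power of \<open>c\<close>, with a polynomial quotient.\<close>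

lemma word_op_expansion:
  fixes X :: "nat \<Rightarrow> 'a::complex_hilbert \<Rightarrow> 'a"
  assumes X: "\<And>i. i \<in> set \<alpha> \<Longrightarrow> is_bop (X i)"
    and T: "\<And>i. i \<in> set \<alpha> \<Longrightarrow> opoly (T i)"
    and Y: "\<And>i c h. i \<in> set \<alpha> \<Longrightarrow> Y c i h = scaleC c (X i h) + scaleC (c ^ 2) (T i c h)"
  shows "\<exists>R. opoly R \<and> (\<forall>c h. word_op (Y c) \<alpha> h
      = scaleC (c ^ length \<alpha>) (word_op X \<alpha> h) + scaleC (c ^ Suc (length \<alpha>)) (R c h))"
  using assms
proof (induction \<alpha>)
  case Nil
  show ?case
    by (rule exI[of _ "\<lambda>c h. 0"]) (simp add: opoly_const is_bop_zero_op)
next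
  case (Cons i \<alpha>)
  then obtain R where R: "opoly R" and eq: "\<And>c h. word_op (Y c) \<alpha> h
      = scaleC (c ^ length \<alpha>) (word_op X \<alpha> h) + scaleC (c ^ Suc (length \<alpha>)) (R c h)"
    by fastforce
  have Xi: "is_bop (X i)" and Ti: "opoly (T i)" and Xa: "is_bop (word_op X \<alpha>)"
    using Cons.prems by (auto intro: is_bop_word_op)
  \<comment> \<open>Read off by multiplying \<open>c X + c^2 T\<close> with the expansion of the
    shorter word and collecting everything beyond the leading term.\<close>
  define S where "S c h = X i (R c h) + T i c (word_op X \<alpha> h + scaleC c (R c h))" for c h
  have "opoly S"
    unfolding S_def[abs_def]
    by (intro opoly_add opoly_comp[OF Ti] opoly_comp[OF opoly_const[OF Xi] R] opoly_shift R
        opoly_const[OF Xa])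
  moreover have "word_op (Y c) (i # \<alpha>) h = scaleC (c ^ length (i # \<alpha>)) (word_op X (i # \<alpha>) h)
      + scaleC (c ^ Suc (length (i # \<alpha>))) (S c h)" for c h
    using Cons.prems(3)[of i]
    by (simp add: eq S_def is_bop_add[OF Xi] is_bop_scaleC[OF Xi] is_bop_add[OF opoly_is_bop[OF Ti]]
        is_bop_scaleC[OF opoly_is_bop[OF Ti]] scaleC_add_right scaleC_scaleC power2_eq_square mult_ac)
  ultimately show ?case by blast
qed

text \<open>Up to order \<open>c ^ Suc m\<close> the m-homogeneous part sees only the linear term of
  its argument. This is what makes Cartan's iteration additive in degree \<open>m\<close>.\<close>

lemma hom_part_expansion:
  fixes X :: "nat \<Rightarrow> 'a::complex_hilbert \<Rightarrow> 'a"
  assumes X: "\<forall>i<n. is_bop (X i)" and T: "\<And>i. i < n \<Longrightarrow> opoly (T i)"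
    and Y: "\<And>i c h. i < n \<Longrightarrow> Y c i h = scaleC c (X i h) + scaleC (c ^ 2) (T i c h)"
  obtains R where "opoly R"
    "\<And>c h. hom_part n a m (Y c) h = scaleC (c ^ m) (hom_part n a m X h) + scaleC (c ^ Suc m) (R c h)"
proof -
  have "\<exists>R. opoly R \<and> (\<forall>c h. word_op (Y c) \<alpha> h
      = scaleC (c ^ m) (word_op X \<alpha> h) + scaleC (c ^ Suc m) (R c h))" if "\<alpha> \<in> words n m" for \<alpha>
  proof -
    have "length \<alpha> = m" and lt: "\<And>i. i \<in> set \<alpha> \<Longrightarrow> i < n"
      using that by (auto simp: words_def)
    then show ?thesis
      using word_op_expansion[of \<alpha> X T Y, OF _ T[OF lt] Y[OF lt]] X by simp
  qed
  then obtain R where R: "\<And>\<alpha>. \<alpha> \<in> words n m \<Longrightarrow> opoly (R \<alpha>)"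
    and eq: "\<And>\<alpha> c h. \<alpha> \<in> words n m \<Longrightarrow> word_op (Y c) \<alpha> h
      = scaleC (c ^ m) (word_op X \<alpha> h) + scaleC (c ^ Suc m) (R \<alpha> c h)"
    by metis
  show thesis
  proof
    show "opoly (\<lambda>c h. \<Sum>\<alpha>\<in>words n m. scaleC (a \<alpha>) (R \<alpha> c h))"
      by (intro opoly_sum opoly_scaleC R)
    show "hom_part n a m (Y c) h = scaleC (c ^ m) (hom_part n a m X h)
        + scaleC (c ^ Suc m) (\<Sum>\<alpha>\<in>words n m. scaleC (a \<alpha>) (R \<alpha> c h))" for c h
      by (simp add: hom_part_def eq scaleC_sum_right scaleC_add_right scaleC_scaleC sum.distrib mult_ac
          del: power_Suc)
  qed
qed

text \<open>As \<open>m\<close> is at least 2, \<open>x\<close>, \<open>y\<close> and the shifted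
  coefficients of \<open>f\<close> occupy the separate degrees 1, \<open>m\<close> and above
  \<open>m\<close>. Hence \<open>y\<close> is the coefficient of \<open>c ^ m\<close> and the Cauchy
  estimate applies.\<close>

lemma vpoly_coefficient_bound:
  fixes f :: "complex \<Rightarrow> 'a::complex_hilbert"
  assumes f: "vpoly f" and m: "2 \<le> m"
    and B: "\<And>c. cmod c = 1 \<Longrightarrow> norm (scaleC c x + scaleC (c ^ m) y + scaleC (c ^ Suc m) (f c)) \<le> B"
  shows "norm y \<le> B"
proof -
  obtain K w where w: "\<And>c. f c = (\<Sum>k<K. scaleC (c ^ k) (w k))"
    using f unfolding vpoly_def by blast
  define v where "v k = (if k = 1 then x else 0) + (if k = m then y else 0)
    + (if k > m then w (k - Suc m) else 0)" for k
  have split: "(\<Sum>k<Suc m + K. g k) = (\<Sum>k<Suc m. g k) + (\<Sum>k<K. g (k + Suc m))" for g :: "nat \<Rightarrow> 'a"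
    by (induction K) (simp_all add: add_ac)
  have "(\<Sum>k<Suc m + K. scaleC (c ^ k) (v k))
      = scaleC c x + scaleC (c ^ m) y + scaleC (c ^ Suc m) (f c)" for c
  proof -
    have "(\<Sum>k<Suc m. scaleC (c ^ k) (v k))
        = (\<Sum>k<Suc m. (if k = 1 then scaleC (c ^ k) x else 0) + (if k = m then scaleC (c ^ k) y else 0))"
      by (intro sum.cong) (auto simp: v_def scaleC_add_right)
    also have "\<dots> = scaleC c x + scaleC (c ^ m) y"
      using m unfolding sum.distrib by (simp del: sum.lessThan_Suc)
    finally have "(\<Sum>k<Suc m. scaleC (c ^ k) (v k)) = scaleC c x + scaleC (c ^ m) y" .
    moreover have "(\<Sum>k<K. scaleC (c ^ (k + Suc m)) (v (k + Suc m))) = scaleC (c ^ Suc m) (f c)"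
      using m by (simp add: w v_def scaleC_sum_right scaleC_scaleC power_add mult_ac)
    ultimately show ?thesis by (simp only: split)
  qed
  then have "norm (\<Sum>k<Suc m + K. scaleC (c ^ k) (v k)) \<le> B" if "cmod c = 1" for c
    using B[OF that] by (simp only:)
  then have "norm (v m) \<le> B"
    by (rule cauchy_coefficient_bound) simp_all
  then show ?thesis
    using m by (simp add: v_def)
qed

section \<open>Cartan's iteration\<close>

text \<open>The map \<open>G\<close> of the overview. The factor \<open>1/2\<close> is the weight
  that the kernel \<open>1 + cos ((m - 1) \<theta>)\<close> gives to degree
  \<open>m\<close>.\<close>

definition hom_shift ::
    "nat \<Rightarrow> (nat \<Rightarrow> nat list \<Rightarrow> complex) \<Rightarrow> nat \<Rightarrow> (nat \<Rightarrow> 'a::complex_hilbert \<Rightarrow> 'a) \<Rightarrow> nat \<Rightarrow> 'a \<Rightarrow> 'a" where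
  "hom_shift n a m X = (\<lambda>i h. X i h + (1/2) *\<^sub>R hom_part n (a i) m X h)"

lemma is_bop_hom_shift: "\<forall>i<n. is_bop (X i) \<Longrightarrow> \<forall>i<n. is_bop (hom_shift n a m X i)"
  by (simp add: hom_shift_def is_bop_add_op is_bop_scaleR_op is_bop_hom_part)

text \<open>Every iterate still has linear term \<open>c X\<close>, so by
  \<open>hom_part_expansion\<close> each further step adds half of the m-homogeneous part of
  \<open>X\<close> in degree \<open>m\<close>.\<close>

lemma hom_shift_iterate_expansion:
  fixes X :: "nat \<Rightarrow> 'a::complex_hilbert \<Rightarrow> 'a"
  assumes X: "\<forall>i<n. is_bop (X i)" and m: "2 \<le> m"
  shows "\<exists>S. \<forall>i<n. opoly (S i) \<and> (\<forall>c h. (hom_shift n a m ^^ N) (\<lambda>i h. scaleC c (X i h)) i h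
      = scaleC c (X i h) + scaleC (c ^ m) ((real N / 2) *\<^sub>R hom_part n (a i) m X h)
        + scaleC (c ^ Suc m) (S i c h))"
proof (induction N)
  case 0
  show ?case
    by (rule exI[of _ "\<lambda>i c h. 0"]) (simp add: opoly_const is_bop_zero_op)
next
  case (Suc N)
  define P where "P i = hom_part n (a i) m X" for i
  define Y where "Y c = (hom_shift n a m ^^ N) (\<lambda>i h. scaleC c (X i h))" for c
  have P: "is_bop (P i)" for i
    using X by (simp add: P_def is_bop_hom_part)
  from Suc obtain S where S: "\<And>i. i < n \<Longrightarrow> opoly (S i)"
    and Y: "\<And>i c h. i < n \<Longrightarrow> Y c i h = scaleC c (X i h) + scaleC (c ^ m) ((real N / 2) *\<^sub>R P i h)
        + scaleC (c ^ Suc m) (S i c h)"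
    unfolding Y_def P_def by blast
  \<comment> \<open>The nonlinear part of \<open>Y\<close> divided by \<open>c ^ 2\<close>; both
    truncated subtractions are genuine because \<open>m\<close> is at least 2.\<close>
  define T where "T i c h = scaleC (c ^ (m - 2)) ((real N / 2) *\<^sub>R P i h) + scaleC (c ^ (m - 1)) (S i c h)"
    for i c h
  have T: "opoly (T i)" if "i < n" for i
    unfolding T_def[abs_def]
    by (intro opoly_add opoly_power_shift opoly_const is_bop_scaleR_op P S that)
  have pw: "c ^ 2 * c ^ (m - 2) = c ^ m" "c ^ 2 * c ^ (m - 1) = c ^ Suc m" for c :: complex
    using m by (auto simp: power_add[symmetric] simp del: power_Suc intro!: arg_cong[where f = "power c"])
  have YT: "Y c i h = scaleC c (X i h) + scaleC (c ^ 2) (T i c h)" if "i < n" for i c h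
    by (simp only: Y[OF that] T_def scaleC_add_right scaleC_scaleC pw add.assoc)
  have "\<exists>R. opoly R \<and> (\<forall>c h. hom_part n (a i) m (Y c) h
      = scaleC (c ^ m) (P i h) + scaleC (c ^ Suc m) (R c h))" for i
    using hom_part_expansion[where T = T and Y = Y and n = n and X = X and a = "a i" and m = m, OF X T YT]
    unfolding P_def by metis
  then obtain R where R: "\<And>i. opoly (R i)" and eq: "\<And>i c h. hom_part n (a i) m (Y c) h
      = scaleC (c ^ m) (P i h) + scaleC (c ^ Suc m) (R i c h)"
    by metis
  define S' where "S' i c h = S i c h + scaleC (of_real (1/2)) (R i c h)" for i c h
  have "opoly (S' i)" if "i < n" for i
    unfolding S'_def[abs_def] by (intro opoly_add opoly_scaleC R S that)
  moreover have "(hom_shift n a m ^^ Suc N) (\<lambda>i h. scaleC c (X i h)) i h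
      = scaleC c (X i h) + scaleC (c ^ m) ((real (Suc N) / 2) *\<^sub>R P i h) + scaleC (c ^ Suc m) (S' i c h)"
    if "i < n" for i c h
  proof -
    have "(hom_shift n a m ^^ Suc N) (\<lambda>i h. scaleC c (X i h)) i h
        = Y c i h + (1/2) *\<^sub>R hom_part n (a i) m (Y c) h"
      by (simp add: hom_shift_def Y_def)
    also have "\<dots> = scaleC c (X i h) + scaleC (c ^ m) ((real N / 2) *\<^sub>R P i h + (1/2) *\<^sub>R P i h)
        + scaleC (c ^ Suc m) (S' i c h)"
      unfolding S'_def scaleC_of_real
      by (simp add: Y[OF that] eq scaleC_add_right scaleR_add_right scaleC_scaleR add_ac
          del: power_Suc)
    also have "(real N / 2) *\<^sub>R P i h + (1/2) *\<^sub>R P i h = (real (Suc N) / 2) *\<^sub>R P i h"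
      by (simp add: scaleR_add_left[symmetric] add_divide_distrib add.commute del: scaleR_half_double)
    finally show ?thesis .
  qed
  ultimately show ?case
    unfolding P_def by blast
qed

text \<open>Invariance at one fixed radius can be iterated: all iterates started at a rotation of
  \<open>X\<close> keep the row bound \<open>\<gamma>\<close>. The Cauchy estimate then bounds
  \<open>N\<close> times the m-homogeneous part uniformly in \<open>N\<close>.\<close>

lemma hom_part_eq_0_of_invariant_ball:
  fixes X :: "nat \<Rightarrow> 'a::complex_hilbert \<Rightarrow> 'a"
  assumes inv: "\<And>Y :: nat \<Rightarrow> 'a \<Rightarrow> 'a. \<forall>i<n. is_bop (Y i) \<Longrightarrow> row_bounded n \<gamma> Y
      \<Longrightarrow> row_bounded n \<gamma> (hom_shift n a m Y)"
    and X: "\<forall>i<n. is_bop (X i)" "row_bounded n \<gamma> X" and m: "2 \<le> m" and i: "i < n"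
  shows "hom_part n (a i) m X h = 0"
proof -
  have bound: "real N * norm (hom_part n (a i) m X h) \<le> 2 * \<gamma> * norm h" for N
  proof -
    define Y where "Y c = (hom_shift n a m ^^ N) (\<lambda>i h. scaleC c (X i h))" for c
    have Yball: "(\<forall>i<n. is_bop (Y c i)) \<and> row_bounded n \<gamma> (Y c)" if "cmod c = 1" for c
      unfolding Y_def
    proof (induction N)
      case 0
      then show ?case
        using X that row_bounded_scaleC[of n \<gamma> X c] by (auto simp: is_bop_scaleC_op)
    next
      case (Suc N)
      then show ?case
        by (auto simp: inv intro: is_bop_hom_shift[rule_format])
    qed
    obtain S where S: "opoly (S i)" and eq: "\<And>c. Y c i h
        = scaleC c (X i h) + scaleC (c ^ m) ((real N / 2) *\<^sub>R hom_part n (a i) m X h)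
        + scaleC (c ^ Suc m) (S i c h)"
      using hom_shift_iterate_expansion[OF X(1) m, where a = a and N = N] i unfolding Y_def by blast
    have "norm ((real N / 2) *\<^sub>R hom_part n (a i) m X h) \<le> \<gamma> * norm h"
    proof (rule vpoly_coefficient_bound[OF _ m])
      show "vpoly (\<lambda>c. S i c h)"
        using S vpoly_const[of h] by (auto simp: opoly_def)
      show "norm (scaleC c (X i h) + scaleC (c ^ m) ((real N / 2) *\<^sub>R hom_part n (a i) m X h)
        + scaleC (c ^ Suc m) (S i c h)) \<le> \<gamma> * norm h" if "cmod c = 1" for c
        using row_bounded_component[of n \<gamma> "Y c" i h] Yball[OF that] i unfolding eq by blast
    qed
    then show ?thesis by simp
  qed
  show ?thesis
  proof (rule ccontr)
    assume "hom_part n (a i) m X h \<noteq> 0"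
    then have "norm (hom_part n (a i) m X h) > 0" by simp
    then obtain N where "2 * \<gamma> * norm h < real N * norm (hom_part n (a i) m X h)"
      using reals_Archimedean3 by blast
    with bound[of N] show False by simp
  qed
qed

text \<open>The hypothesis on the function gives information only at radii below
  \<open>\<gamma>\<close>. It is applied to \<open>t X\<close> with \<open>t < 1\<close>, and
  \<open>t\<close> tends to 1, the expression being polynomial in \<open>t\<close>.\<close>

lemma hom_shift_closed_ball:
  fixes X :: "nat \<Rightarrow> 'a::complex_hilbert \<Rightarrow> 'a"
  assumes "\<gamma> > 0" and X: "\<forall>i<n. is_bop (X i)" "row_bounded n \<gamma> X"
    and inv: "\<And>r Y :: nat \<Rightarrow> 'a \<Rightarrow> 'a. 0 \<le> r \<Longrightarrow> r < \<gamma> \<Longrightarrow> \<forall>i<n. is_bop (Y i) \<Longrightarrow> row_bounded n r Y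
      \<Longrightarrow> row_bounded n \<gamma> (hom_shift n a m Y)"
  shows "row_bounded n \<gamma> (hom_shift n a m X)"
  unfolding row_bounded_def
proof
  fix h :: "nat \<Rightarrow> 'a"
  define t where "t k = real k / real (Suc k)" for k
  have t: "t \<longlonglongrightarrow> 1" "0 \<le> t k" "t k < 1" for k
    unfolding t_def[abs_def] by (rule LIMSEQ_n_over_Suc_n) auto
  let ?X = "\<lambda>k i h. scaleC (of_real (t k)) (X i h)"
  let ?B = "\<gamma> * L2_set (\<lambda>i. norm (h i)) {..<n}"
  have eq: "hom_shift n a m (?X k) i x = t k *\<^sub>R X i x + (1/2) *\<^sub>R (t k ^ m *\<^sub>R hom_part n (a i) m X x)" for k i x
    by (simp only: hom_shift_def hom_part_scaleC[OF X(1)] of_real_power[symmetric])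
      (simp only: scaleC_of_real)
  have "(\<lambda>k. norm (\<Sum>i<n. hom_shift n a m (?X k) i (h i)))
      \<longlonglongrightarrow> norm (\<Sum>i<n. 1 *\<^sub>R X i (h i) + (1/2) *\<^sub>R (1 ^ m *\<^sub>R hom_part n (a i) m X (h i)))"
    unfolding eq by (intro tendsto_intros t)
  moreover have "norm (\<Sum>i<n. hom_shift n a m (?X k) i (h i)) \<le> ?B" for k
  proof -
    have "row_bounded n (t k * \<gamma>) (?X k)"
      using row_bounded_scaleC[OF X(2), of "of_real (t k)"] t(2)[of k] by simp
    then have "row_bounded n \<gamma> (hom_shift n a m (?X k))"
      using t(2,3)[of k] \<open>\<gamma> > 0\<close> X(1)
      by (intro inv[of "t k * \<gamma>"]) (auto intro: is_bop_scaleC_op)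
    then show ?thesis by (simp add: row_bounded_def)
  qed
  ultimately have "norm (\<Sum>i<n. 1 *\<^sub>R X i (h i) + (1/2) *\<^sub>R (1 ^ m *\<^sub>R hom_part n (a i) m X (h i))) \<le> ?B"
    by (intro LIMSEQ_le_const2) auto
  then show "norm (\<Sum>i<n. hom_shift n a m X i (h i)) \<le> ?B"
    by (simp add: hom_shift_def)
qed

text \<open>Only the empty word survives at the zero tuple, so \<open>F(0) = 0\<close> kills the
  homogeneous part of degree 0.\<close>

lemma fh_eval_zero_tuple: "fh_eval n a (\<lambda>j h. 0) h = scaleC (a []) h"
proof -
  have "word_op (\<lambda>j h. 0) \<alpha> h = 0" if "\<alpha> \<noteq> []" for \<alpha> and h :: 'a
    using that by (cases \<alpha>) auto
  then have "hom_part n a k (\<lambda>j h. 0) h = 0" if "k \<noteq> 0" for k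
    unfolding hom_part_def using that by (intro sum.neutral) (force simp: words_def)
  then have "(\<lambda>k. hom_part n a k (\<lambda>j h. 0) h) sums (\<Sum>k\<in>{0}. hom_part n a k (\<lambda>j h. 0) h)"
    by (intro sums_finite) auto
  then show ?thesis
    by (simp add: fh_eval_def sums_iff hom_part_0)
qed

theorem mainTheorem3:
  fixes n :: nat and \<gamma> :: real
    and a :: "nat \<Rightarrow> nat list \<Rightarrow> complex"
  assumes gamma_pos: "\<gamma> > 0"
    and holo: "\<forall>i<n. free_holomorphic n \<gamma> (a i)"
    and maps_ball: "\<forall>X \<in> (nc_ball n \<gamma> :: (nat \<Rightarrow> ('h::complex_hilbert \<Rightarrow> 'h)) set).
                       (\<lambda>i. fh_eval n (a i) X) \<in> nc_ball n \<gamma>"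
    and F0: "\<forall>i<n. fh_eval n (a i) (\<lambda>j. (\<lambda>h. 0) :: 'h \<Rightarrow> 'h) = (\<lambda>h. 0)"
    and D0: "\<forall>i<n. \<forall>j<n. free_deriv0 a i j = (if i = j then 1 else 0)"
  shows "\<forall>X \<in> (nc_ball n \<gamma> :: (nat \<Rightarrow> ('h \<Rightarrow> 'h)) set). \<forall>i<n. fh_eval n (a i) X = X i"
proof (intro ballI allI impI ext)
  have P0: "hom_part n (a i) 0 X h = 0" if "i < n" for i h and X :: "nat \<Rightarrow> 'h \<Rightarrow> 'h"
    using F0 that by (metis hom_part_0 fh_eval_zero_tuple)
  have P1: "hom_part n (a i) 1 X h = X i h" if "i < n" for i h and X :: "nat \<Rightarrow> 'h \<Rightarrow> 'h"
  proof -
    have "hom_part n (a i) 1 X h = (\<Sum>j<n. if j = i then X i h else 0)"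
      unfolding hom_part_1 using D0 that by (intro sum.cong) (auto simp: free_deriv0_def)
    then show ?thesis using that by simp
  qed
  have inv: "row_bounded n \<gamma> (hom_shift n (a :: nat \<Rightarrow> nat list \<Rightarrow> complex) m X)"
    if r: "0 \<le> r" "r < \<gamma>" and X: "\<forall>i<n. is_bop (X i)" and row: "row_bounded n r X" and m: "2 \<le> m"
    for r m and X :: "nat \<Rightarrow> 'h \<Rightarrow> 'h"
    unfolding row_bounded_def
  proof
    fix h :: "nat \<Rightarrow> 'h"
    \<comment> \<open>For fixed \<open>h\<close> these are the coefficients in \<open>c\<close> of
      the row \<open>F(c X)\<close> applied to \<open>h\<close>, which reduces the row norm estimate
      to a single vector-valued series.\<close>
    define v where "v k = (\<Sum>i<n. hom_part n (a i) k X (h i))" for k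
    note sm = summable_norm_hom_part[OF holo[rule_format] row r X]
    let ?B = "\<gamma> * L2_set (\<lambda>i. norm (h i)) {..<n}"
    have "norm (v 1 + (1/2) *\<^sub>R v m) \<le> ?B"
    proof (rule fejer_coefficient_bound_series[OF _ _ m])
      show "summable (\<lambda>k. norm (v k))"
        by (rule summable_comparison_test'[OF summable_sum[of "{..<n}" "\<lambda>i k. norm (hom_part n (a i) k X (h i))"]])
          (auto simp: sm v_def intro: norm_sum)
      show "v 0 = 0" by (simp add: v_def P0)
      fix c :: complex assume c: "cmod c = 1"
      let ?X = "\<lambda>i h. scaleC c (X i h)"
      have "row_bounded n r ?X"
        using row_bounded_scaleC[OF row, of c] c by simp
      then have "?X \<in> nc_ball n \<gamma>"
        by (rule row_bounded_imp_nc_ball[rotated]) (use X r in \<open>auto intro: is_bop_scaleC_op\<close>)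
      then have "(\<lambda>i. fh_eval n (a i) ?X) \<in> nc_ball n \<gamma>"
        using maps_ball by blast
      then obtain s where s: "s < \<gamma>" "row_bounded n s (\<lambda>i. fh_eval n (a i) ?X)"
        by (rule nc_ball_imp_row_bounded)
      have sc: "summable (\<lambda>k. scaleC (c ^ k) (hom_part n (a i) k X (h i)))" if "i < n" for i
        by (rule summable_norm_cancel) (use sm[OF that] c in \<open>simp add: norm_scaleC norm_power\<close>)
      have "(\<Sum>k. scaleC (c ^ k) (v k)) = (\<Sum>i<n. fh_eval n (a i) ?X (h i))"
        unfolding v_def scaleC_sum_right fh_eval_def hom_part_scaleC[OF X]
        by (rule suminf_sum) (simp add: sc)
      also have "norm \<dots> \<le> s * L2_set (\<lambda>i. norm (h i)) {..<n}"
        using s by (simp add: row_bounded_def)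
      also have "\<dots> \<le> ?B"
        using s by (intro mult_right_mono) auto
      finally show "norm (\<Sum>k. scaleC (c ^ k) (v k)) \<le> ?B" .
    qed
    \<comment> \<open>By \<open>P1\<close> the coefficient \<open>v 1\<close> is the row
      \<open>X\<close> applied to \<open>h\<close>, so the averaged bound is the one for
      \<open>hom_shift\<close>.\<close>
    moreover have "(\<Sum>i<n. hom_shift n a m X i (h i)) = v 1 + (1/2) *\<^sub>R v m"
      by (simp add: hom_shift_def v_def sum.distrib scaleR_sum_right P1[unfolded One_nat_def])
    ultimately show "norm (\<Sum>i<n. hom_shift n a m X i (h i)) \<le> ?B" by simp
  qed
  fix X :: "nat \<Rightarrow> 'h \<Rightarrow> 'h" and i h
  assume X: "X \<in> nc_ball n \<gamma>" and i: "i < n"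
  have bop: "\<forall>i<n. is_bop (X i)" using X by (simp add: nc_ball_def)
  obtain r where r: "r < \<gamma>" "row_bounded n r X"
    using nc_ball_imp_row_bounded[OF X] .
  have row: "row_bounded n \<gamma> X"
    unfolding row_bounded_def
    using r(2)[unfolded row_bounded_def] r(1)
    by (meson L2_set_nonneg less_imp_le mult_right_mono order.trans)
  \<comment> \<open>\<open>inv\<close> starts from radii strictly below \<open>\<gamma>\<close>;
    \<open>hom_shift_closed_ball\<close> upgrades it to the invariance that can be iterated.\<close>
  have "hom_part n (a i) m X h = 0" if "2 \<le> m" for m
    by (rule hom_part_eq_0_of_invariant_ball[OF _ bop row that i])
      (rule hom_shift_closed_ball[OF gamma_pos _ _ inv], use that in auto)
  then have "hom_part n (a i) k X h = 0" if "k \<noteq> 1" for k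
    using that P0[OF i, of X h] by (cases "k = 0") auto
  then have "(\<lambda>k. hom_part n (a i) k X h) sums (\<Sum>k\<in>{1}. hom_part n (a i) k X h)"
    by (intro sums_finite) auto
  then show "fh_eval n (a i) X h = X i h"
    using P1[OF i, of X h] by (simp add: fh_eval_def sums_iff)
qed

end
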